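(* Let $n\ge 1$, let $\mathcal{A}=\|a_{ij}\|_{i,j=1}^n$ be a real symmetric $n\times n$ matrix, let $d>0$, and let $J=J(\{\beta_j\},\{\alpha_j\})$ be a (one-sided) Jacobi matrix. Consider the infinite matrix, viewed as an operator on $\ell^2=\ell^2(\mathbb{N})$ in the standard basis, $$A=\begin{bmatrix}\mathcal{A} & I_d\\ I_d^* & J\end{bmatrix},\qquad I_d=\begin{bmatrix}0&0&0&\ldots\\ \vdots&\vdots&\vdots&\\ 0&0&0&\ldots\\ d&0&0&\ldots\end{bmatrix},$$ where $I_d$ is the $n\times\infty$ matrix whose only nonzero entry is $d$ in position $(n,1)$. Then there exist an integer $k$ with $1\le k\le n$, a real symmetric matrix $\widehat{\mathcal{A}}$ of order $n-k$ (absent if $k=n$), a Jacobi matrix $\widehat J$ which is an extension of $J$, and a unitary operator $U$ on $\ell^2$ such that $$U^{-1}AU=\widehat{\mathcal{A}}\oplus\widehat J.$$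
   Context: A (one-sided) Jacobi matrix is an infinite matrix $J(\{b_j\},\{a_j\})$ with diagonal entries $b_1,b_2,\ldots\in\mathbb{R}$, entries $a_1,a_2,\ldots>0$ on the first super- and sub-diagonals, and zeros elsewhere, acting on $\ell^2(\mathbb{N})$. Given two Jacobi matrices $J_k=J(\{\beta^{(k)}_j\},\{\alpha^{(k)}_j\})$, $k=1,2$, $J_1$ is called an extension of $J_2$ if there is $q\in\mathbb{N}$ with $\beta^{(2)}_j=\beta^{(1)}_{j+q}$ and $\alpha^{(2)}_j=\alpha^{(1)}_{j+q}$ for all $j\in\mathbb{N}$, i.e. $J_2$ is obtained from $J_1$ by deleting its first $q$ rows and columns. *)

theory Defs
  imports Complex_Main "Jordan_Normal_Form.Matrix"
begin

text \<open>Infinite matrices are indexed from 0, so the entry at \<open>(i, j)\<close> below is the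
  entry at \<open>(i + 1, j + 1)\<close> in the usual numbering; likewise for sequences.\<close>

type_synonym infmat = "nat \<Rightarrow> nat \<Rightarrow> real"

definition ell2 :: "(nat \<Rightarrow> complex) set" where
  "ell2 = {x. summable (\<lambda>j. (cmod (x j))\<^sup>2)}"

definition ell2_inner :: "(nat \<Rightarrow> complex) \<Rightarrow> (nat \<Rightarrow> complex) \<Rightarrow> complex" where
  "ell2_inner x y = (\<Sum>j. x j * cnj (y j))"

definition unitary_ell2 :: "((nat \<Rightarrow> complex) \<Rightarrow> (nat \<Rightarrow> complex)) \<Rightarrow> bool" where
  "unitary_ell2 U \<longleftrightarrow>
     bij_betw U ell2 ell2 \<and>
     (\<forall>x\<in>ell2. \<forall>y\<in>ell2. U (\<lambda>j. x j + y j) = (\<lambda>j. U x j + U y j)) \<and>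
     (\<forall>c. \<forall>x\<in>ell2. U (\<lambda>j. c * x j) = (\<lambda>j. c * U x j)) \<and>
     (\<forall>x\<in>ell2. \<forall>y\<in>ell2. ell2_inner (U x) (U y) = ell2_inner x y)"

definition infmat_apply :: "infmat \<Rightarrow> (nat \<Rightarrow> complex) \<Rightarrow> (nat \<Rightarrow> complex)" where
  "infmat_apply M x = (\<lambda>i. \<Sum>j. complex_of_real (M i j) * x j)"

text \<open>The entries are not assumed bounded, so the operator of a matrix is taken on its maximal
  domain, which is all of \<open>ell2\<close> if the matrix is bounded. For a symmetric matrix with
  finitely supported rows this operator is the adjoint of the closure of the one defined on
  finitely supported vectors. Hence a unitary operator intertwines two maximal operators of this
  kind iff it intertwines the two minimal closed ones.\<close>

definition infmat_dom :: "infmat \<Rightarrow> (nat \<Rightarrow> complex) set" where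
  "infmat_dom M = {x \<in> ell2.
     (\<forall>i. summable (\<lambda>j. complex_of_real (M i j) * x j)) \<and> infmat_apply M x \<in> ell2}"

text \<open>The equality \<open>U\<^sup>-\<^sup>1 A U = B\<close> of possibly unbounded operators, including
  equality of the domains.\<close>

definition conj_eq :: "((nat \<Rightarrow> complex) \<Rightarrow> (nat \<Rightarrow> complex)) \<Rightarrow> infmat \<Rightarrow> infmat \<Rightarrow> bool" where
  "conj_eq U A B \<longleftrightarrow>
     {x \<in> ell2. U x \<in> infmat_dom A} = infmat_dom B \<and>
     (\<forall>x \<in> infmat_dom B. inv_into ell2 U (infmat_apply A (U x)) = infmat_apply B x)"

definition jacobi :: "(nat \<Rightarrow> real) \<Rightarrow> (nat \<Rightarrow> real) \<Rightarrow> infmat" where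
  "jacobi b a = (\<lambda>i j. if i = j then b i
                       else if j = Suc i then a i
                       else if i = Suc j then a j
                       else 0)"

text \<open>\<open>jacobi b1 a1\<close> is an extension of \<open>jacobi b2 a2\<close>; at least one row
  and column is deleted.\<close>

definition jacobi_extension ::
  "(nat \<Rightarrow> real) \<Rightarrow> (nat \<Rightarrow> real) \<Rightarrow> (nat \<Rightarrow> real) \<Rightarrow> (nat \<Rightarrow> real) \<Rightarrow> bool" where
  "jacobi_extension b1 a1 b2 a2 \<longleftrightarrow>
     (\<exists>q\<ge>1. \<forall>j. b2 j = b1 (j + q) \<and> a2 j = a1 (j + q))"

text \<open>The upper left block is finite and square, possibly of order 0.\<close>

definition block_infmat :: "real mat \<Rightarrow> infmat \<Rightarrow> infmat \<Rightarrow> infmat \<Rightarrow> infmat" where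
  "block_infmat A B C D = (\<lambda>i j. let n = dim_row A in
     if i < n then (if j < n then A $$ (i, j) else B i (j - n))
     else (if j < n then C (i - n) j else D (i - n) (j - n)))"

definition coupling :: "nat \<Rightarrow> real \<Rightarrow> infmat" where
  "coupling n d = (\<lambda>i j. if i = n - 1 \<and> j = 0 then d else 0)"

definition infmat_transpose :: "infmat \<Rightarrow> infmat" where
  "infmat_transpose M = (\<lambda>i j. M j i)"

definition direct_sum_infmat :: "real mat \<Rightarrow> infmat \<Rightarrow> infmat" where
  "direct_sum_infmat A D = block_infmat A (\<lambda>_ _. 0) (\<lambda>_ _. 0) D"

end

theory Submission
  imports Defs
begin

text \<open>Write the last column of the finite block as \<open>(v, c)\<close> with \<open>v\<close> of
  length \<open>n - 1\<close>. If \<open>v = 0\<close>, the matrix already is the direct sum of the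
  leading block of order \<open>n - 1\<close> and the Jacobi matrix with \<open>c\<close> and \<open>d\<close>
  prepended to its parameters. Otherwise a Householder reflection acting on the first
  \<open>n - 1\<close> coordinates maps \<open>v\<close> to a positive multiple of the last basis vector, and
  conjugation by it gives a matrix of the same shape with a finite block of order \<open>n - 1\<close>,
  coupling constant \<open>|v|\<close> and the same prepended Jacobi matrix. Induction on \<open>n\<close>
  finishes the proof.\<close>

section \<open>Matrix operators on their maximal domains and unitary conjugation\<close>

lemma infmat_apply_sums:
  assumes "\<And>i. summable (\<lambda>j. complex_of_real (M i j) * x j)"
  shows "(\<lambda>j. complex_of_real (M i j) * x j) sums infmat_apply M x i"
  using assms by (simp add: infmat_apply_def summable_sums)

lemma summable_row_finite:
  fixes x :: "nat \<Rightarrow> complex"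
  assumes "finite {j. M i j \<noteq> (0::real)}"
  shows "summable (\<lambda>j. complex_of_real (M i j) * x j)"
  by (rule summable_finite[OF assms]) auto

lemma summable_ell2_product:
  assumes "x \<in> ell2" "y \<in> ell2"
  shows "summable (\<lambda>j. x j * cnj (y j))"
proof (rule summable_comparison_test')
  show "summable (\<lambda>j. (cmod (x j))\<^sup>2 + (cmod (y j))\<^sup>2)"
    using assms by (auto simp: ell2_def intro: summable_add)
  fix j
  have "0 \<le> (cmod (x j) - cmod (y j))\<^sup>2" "0 \<le> (cmod (x j))\<^sup>2" "0 \<le> (cmod (y j))\<^sup>2"
    by simp_all
  then show "norm (x j * cnj (y j)) \<le> (cmod (x j))\<^sup>2 + (cmod (y j))\<^sup>2"
    unfolding power2_diff norm_mult complex_mod_cnj by linarith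
qed

lemma unitary_ell2_id: "unitary_ell2 id"
  by (simp add: unitary_ell2_def)

lemma unitary_ell2_comp:
  assumes "unitary_ell2 V" "unitary_ell2 W"
  shows "unitary_ell2 (V \<circ> W)"
proof -
  have W: "W x \<in> ell2" if "x \<in> ell2" for x
    using assms(2) that by (auto simp: unitary_ell2_def bij_betw_def)
  show ?thesis
    using assms W by (auto simp: unitary_ell2_def intro: bij_betw_trans)
qed

lemma conj_eq_id: "conj_eq id A A"
  by (auto simp: conj_eq_def infmat_dom_def inv_into_f_f[of id ell2, simplified])

text \<open>Domains are pulled back first along \<open>V\<close>, then along \<open>W\<close>, and
  the inverse of the composition undoes \<open>V\<close> first.\<close>

lemma conj_eq_comp:
  assumes V: "unitary_ell2 V" "conj_eq V A B" and W: "unitary_ell2 W" "conj_eq W B C"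
  shows "conj_eq (V \<circ> W) A C"
proof -
  have bV: "bij_betw V ell2 ell2" and bW: "bij_betw W ell2 ell2"
    using V W by (auto simp: unitary_ell2_def)
  have We: "W x \<in> ell2" if "x \<in> ell2" for x
    using bW that by (auto simp: bij_betw_def)
  have domV: "V x \<in> infmat_dom A \<longleftrightarrow> x \<in> infmat_dom B" if "x \<in> ell2" for x
    using V(2) that unfolding conj_eq_def by blast
  have domW: "{x \<in> ell2. W x \<in> infmat_dom B} = infmat_dom C"
    using W(2) unfolding conj_eq_def by blast
  show ?thesis
    unfolding conj_eq_def
  proof (intro conjI ballI)
    show "{x \<in> ell2. (V \<circ> W) x \<in> infmat_dom A} = infmat_dom C"
      using domV We domW by auto
    fix x assume x: "x \<in> infmat_dom C"
    then have Wx: "W x \<in> infmat_dom B" and "x \<in> ell2"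
      using domW by auto
    \<comment> \<open>\<open>inv_into\<close> is meaningful only on the image of
      \<open>ell2\<close>; membership in the maximal domain is what places the vector to be inverted
      there.\<close>
    then have "V (W x) \<in> infmat_dom A"
      using domV We by blast
    then have "infmat_apply A (V (W x)) \<in> ell2"
      by (simp add: infmat_dom_def)
    then have "inv_into ell2 (V \<circ> W) (infmat_apply A (V (W x)))
        = inv_into ell2 W (inv_into ell2 V (infmat_apply A (V (W x))))"
      using bV bW inv_into_comp[of V W ell2] by (simp add: bij_betw_def)
    also have "inv_into ell2 V (infmat_apply A (V (W x))) = infmat_apply B (W x)"
      using V(2) Wx by (simp add: conj_eq_def)
    also have "inv_into ell2 W (infmat_apply B (W x)) = infmat_apply C x"
      using W(2) x by (simp add: conj_eq_def)
    finally show "inv_into ell2 (V \<circ> W) (infmat_apply A ((V \<circ> W) x)) = infmat_apply C x"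
      by (simp add: comp_def)
  qed
qed

text \<open>When every row series converges for every sequence, the only remaining domain condition
  is that the image lies in \<open>ell2\<close>. If \<open>U\<close> acts on all sequences and both
  preserves and reflects membership in \<open>ell2\<close>, a pointwise identity A U = U B therefore
  settles domains and values at once.\<close>

lemma conj_eq_intertwining:
  assumes U: "unitary_ell2 U" and ell2: "\<And>x. U x \<in> ell2 \<longleftrightarrow> x \<in> ell2"
    and A: "\<And>x i. summable (\<lambda>j. complex_of_real (A i j) * x j)"
    and B: "\<And>x i. summable (\<lambda>j. complex_of_real (B i j) * x j)"
    and eq: "\<And>x. infmat_apply A (U x) = U (infmat_apply B x)"
  shows "conj_eq U A B"
  unfolding conj_eq_def
proof (intro conjI ballI)
  show "{x \<in> ell2. U x \<in> infmat_dom A} = infmat_dom B"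
    by (auto simp: infmat_dom_def A B eq ell2)
  fix x assume "x \<in> infmat_dom B"
  then have "infmat_apply B x \<in> ell2"
    by (simp add: infmat_dom_def)
  then show "inv_into ell2 U (infmat_apply A (U x)) = infmat_apply B x"
    using U by (simp add: eq unitary_ell2_def bij_betw_def inv_into_f_f)
qed

section \<open>Householder reflections and their action on symmetric row-finite matrices\<close>

text \<open>The reflection in the hyperplane orthogonal to \<open>w\<close>; since \<open>2 / 0 = 0\<close>, it is
  the identity if \<open>w = 0\<close>.\<close>

locale householder =
  fixes m :: nat and w :: "nat \<Rightarrow> real"
  assumes support: "\<And>i. m \<le> i \<Longrightarrow> w i = 0"
begin

definition \<tau> :: real where
  "\<tau> = 2 / (\<Sum>j<m. (w j)\<^sup>2)"

text \<open>Since \<open>w\<close> is real, this is the inner product of \<open>x\<close> with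
  \<open>w\<close>; being a finite sum, it makes sense for arbitrary sequences, and so does
  \<open>reflect\<close>.\<close>

definition proj :: "(nat \<Rightarrow> complex) \<Rightarrow> complex" where
  "proj x = (\<Sum>j<m. complex_of_real (w j) * x j)"

definition reflect :: "(nat \<Rightarrow> complex) \<Rightarrow> (nat \<Rightarrow> complex)" where
  "reflect x = (\<lambda>i. x i - complex_of_real (\<tau> * w i) * proj x)"

definition image_vec :: "infmat \<Rightarrow> nat \<Rightarrow> real" where
  "image_vec M i = (\<Sum>j<m. M i j * w j)"

definition quad_form :: "infmat \<Rightarrow> real" where
  "quad_form M = (\<Sum>i<m. w i * image_vec M i)"

text \<open>For symmetric M this is H M H multiplied out, where H = I - \<tau> w w^T;
  \<open>image_vec M\<close> is M w and \<open>quad_form M\<close> is w^T M w.\<close>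

definition conjugate :: "infmat \<Rightarrow> infmat" where
  "conjugate M = (\<lambda>i j. M i j - \<tau> * w i * image_vec M j - \<tau> * image_vec M i * w j
     + \<tau>\<^sup>2 * quad_form M * w i * w j)"

text \<open>This is the scalar identity behind H^2 = I. In product form it also covers
  \<open>w = 0\<close>, where both sides vanish, so the identities built on it need no case
  split.\<close>

lemma tau_norm: "\<tau> * \<tau> * (\<Sum>j<m. (w j)\<^sup>2) = 2 * \<tau>"
  by (cases "(\<Sum>j<m. (w j)\<^sup>2) = 0") (simp_all add: \<tau>_def)

lemma tau_norm_complex:
  "complex_of_real \<tau> * complex_of_real \<tau> * complex_of_real (\<Sum>j<m. (w j)\<^sup>2) = 2 * complex_of_real \<tau>"
  using arg_cong[OF tau_norm, of complex_of_real] by (simp only: of_real_mult of_real_numeral)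

lemma proj_w: "proj (\<lambda>i. complex_of_real (w i)) = complex_of_real (\<Sum>j<m. (w j)\<^sup>2)"
  by (simp add: proj_def power2_eq_square)

lemma proj_add: "proj (\<lambda>i. x i + y i) = proj x + proj y"
  by (simp add: proj_def distrib_left sum.distrib)

lemma proj_diff: "proj (\<lambda>i. x i - y i) = proj x - proj y"
  by (simp add: proj_def right_diff_distrib sum_subtractf)

lemma proj_scale: "proj (\<lambda>i. c * x i) = c * proj x"
  by (simp add: proj_def sum_distrib_left mult.left_commute)

lemma proj_sums: "(\<lambda>j. complex_of_real (w j) * x j) sums proj x"
  unfolding proj_def by (rule sums_finite) (auto simp: support)

lemma reflect_alt: "reflect x = (\<lambda>i. x i - (complex_of_real \<tau> * proj x) * complex_of_real (w i))"
  by (simp add: reflect_def ac_simps)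

lemma reflect_apply: "reflect x i = x i - (complex_of_real \<tau> * proj x) * complex_of_real (w i)"
  by (simp add: reflect_alt)

lemma reflect_involution: "reflect (reflect x) = x"
proof
  fix i
  have proj_reflect: "proj (reflect x)
      = proj x - complex_of_real \<tau> * proj x * complex_of_real (\<Sum>j<m. (w j)\<^sup>2)"
    by (simp only: reflect_alt proj_diff proj_scale proj_w)
  have "reflect (reflect x) i = x i
      + (complex_of_real \<tau> * complex_of_real \<tau> * complex_of_real (\<Sum>j<m. (w j)\<^sup>2)
         - 2 * complex_of_real \<tau>) * proj x * complex_of_real (w i)"
    by (simp only: reflect_apply proj_reflect) (simp add: algebra_simps)
  then show "reflect (reflect x) i = x i"
    by (simp only: tau_norm_complex) simp
qed

lemma reflect_in_ell2: "reflect x \<in> ell2 \<longleftrightarrow> x \<in> ell2"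
proof -
  have "\<forall>\<^sub>F j in sequentially. (cmod (reflect x j))\<^sup>2 = (cmod (x j))\<^sup>2"
    unfolding eventually_sequentially by (rule exI[of _ m]) (auto simp: reflect_def support)
  then show ?thesis
    by (simp add: ell2_def summable_cong)
qed

text \<open>Expanding the product gives four convergent series. The three correction terms add up to
  a multiple of \<tau>^2 |w|^2 - 2 \<tau>, which is zero by \<open>tau_norm\<close>.\<close>

lemma reflect_inner:
  assumes "x \<in> ell2" "y \<in> ell2"
  shows "ell2_inner (reflect x) (reflect y) = ell2_inner x y"
proof -
  let ?t = "complex_of_real \<tau>" and ?w = "\<lambda>j. complex_of_real (w j)"
  define p q where "p = proj x" and "q = cnj (proj y)"
  have "(\<lambda>j. x j * cnj (y j)) sums ell2_inner x y"
    using summable_ell2_product[OF assms] by (simp add: ell2_inner_def summable_sums)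
  moreover have "(\<lambda>j. ?w j * x j) sums p"
    unfolding p_def by (rule proj_sums)
  \<comment> \<open>As \<open>w\<close> is real, conjugating the series for \<open>proj y\<close>
    only conjugates \<open>y\<close>.\<close>
  moreover have "(\<lambda>j. ?w j * cnj (y j)) sums q"
    using proj_sums[of y] unfolding q_def by (subst sums_cnj[symmetric]) simp
  moreover have "(\<lambda>j. ?w j * ?w j) sums complex_of_real (\<Sum>j<m. (w j)\<^sup>2)"
    using proj_sums[of ?w] by (simp only: proj_w)
  ultimately have "(\<lambda>j. x j * cnj (y j) - (?t * q) * (?w j * x j) - (?t * p) * (?w j * cnj (y j))
        + (?t * ?t * p * q) * (?w j * ?w j))
      sums (ell2_inner x y - (?t * q) * p - (?t * p) * q
        + (?t * ?t * p * q) * complex_of_real (\<Sum>j<m. (w j)\<^sup>2))"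
    by (intro sums_add sums_diff sums_mult)
  moreover have "reflect x j * cnj (reflect y j) = x j * cnj (y j) - (?t * q) * (?w j * x j)
      - (?t * p) * (?w j * cnj (y j)) + (?t * ?t * p * q) * (?w j * ?w j)" for j
    by (simp add: reflect_alt p_def q_def algebra_simps)
  moreover have "ell2_inner x y - (?t * q) * p - (?t * p) * q
        + (?t * ?t * p * q) * complex_of_real (\<Sum>j<m. (w j)\<^sup>2)
      = ell2_inner x y + (?t * ?t * complex_of_real (\<Sum>j<m. (w j)\<^sup>2) - 2 * ?t) * p * q"
    by (simp add: algebra_simps)
  ultimately have "(\<lambda>j. reflect x j * cnj (reflect y j)) sums ell2_inner x y"
    by (simp only: tau_norm_complex) simp
  then show ?thesis
    by (simp add: ell2_inner_def[of "reflect x"] sums_unique[symmetric])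
qed

lemma unitary_reflect: "unitary_ell2 reflect"
  unfolding unitary_ell2_def
proof (intro conjI ballI allI)
  show "bij_betw reflect ell2 ell2"
    by (rule bij_betwI[where g = reflect]) (auto simp: reflect_in_ell2 reflect_involution)
  show "reflect (\<lambda>j. x j + y j) = (\<lambda>j. reflect x j + reflect y j)" for x y
    by (simp add: reflect_def proj_add algebra_simps)
  show "reflect (\<lambda>j. c * x j) = (\<lambda>j. c * reflect x j)" for c x
    by (simp add: reflect_def proj_scale algebra_simps)
qed (rule reflect_inner)

context
  fixes M :: infmat
  assumes sym: "\<And>i j. M i j = M j i"
    and row_finite: "\<And>i. finite {j. M i j \<noteq> 0}"
begin

text \<open>Symmetry moves M across the pairing: (M w, x) = (w, M x). The interchange of summations
  is harmless because \<open>w\<close> has finite support.\<close>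

lemma image_vec_sums:
  "(\<lambda>j. complex_of_real (image_vec M j) * x j) sums proj (infmat_apply M x)"
proof -
  have "(\<lambda>j. \<Sum>l<m. complex_of_real (w l) * (complex_of_real (M l j) * x j))
      sums (\<Sum>l<m. complex_of_real (w l) * infmat_apply M x l)"
    by (intro sums_sum sums_mult infmat_apply_sums summable_row_finite row_finite)
  moreover have "(\<Sum>l<m. complex_of_real (w l) * (complex_of_real (M l j) * x j))
      = complex_of_real (image_vec M j) * x j" for j
    unfolding image_vec_def of_real_sum sum_distrib_right
    by (intro sum.cong refl) (simp add: sym[of j] ac_simps)
  ultimately show ?thesis
    by (simp add: proj_def)
qed

lemma proj_image_vec: "proj (\<lambda>i. complex_of_real (image_vec M i)) = complex_of_real (quad_form M)"
  by (simp add: proj_def quad_form_def)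

text \<open>The sum is row \<open>i\<close> of H M H x, expressed through M x. It serves twice: its
  convergence gives the row condition on the domain of \<open>conjugate M\<close>, its value gives
  the intertwining relation.\<close>

lemma conjugate_sums:
  "(\<lambda>j. complex_of_real (conjugate M i j) * x j) sums
    (infmat_apply M x i - (complex_of_real \<tau> * proj (infmat_apply M x)) * complex_of_real (w i)
      - (complex_of_real \<tau> * proj x) * complex_of_real (image_vec M i)
      + (complex_of_real \<tau> * complex_of_real \<tau> * complex_of_real (quad_form M) * proj x)
        * complex_of_real (w i))"
    (is "?f sums ?s")
proof -
  let ?t = "complex_of_real \<tau>" and ?w = "\<lambda>j. complex_of_real (w j)"
    and ?g = "\<lambda>j. complex_of_real (image_vec M j)" and ?q = "complex_of_real (quad_form M)"
  have "(\<lambda>j. complex_of_real (M i j) * x j - (?t * ?w i) * (?g j * x j)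
        - (?t * ?g i) * (?w j * x j) + (?t * ?t * ?q * ?w i) * (?w j * x j))
      sums (infmat_apply M x i - (?t * ?w i) * proj (infmat_apply M x)
        - (?t * ?g i) * proj x + (?t * ?t * ?q * ?w i) * proj x)"
    by (intro sums_add sums_diff sums_mult infmat_apply_sums summable_row_finite row_finite
        proj_sums image_vec_sums)
  then show ?thesis
    by (simp add: conjugate_def power2_eq_square algebra_simps)
qed

text \<open>In matrix form, M H = H (H M H) because H^2 = I. In coordinates, the two sides differ by
  a multiple of \<tau>^2 |w|^2 - 2 \<tau>.\<close>

lemma reflect_intertwining: "infmat_apply M (reflect x) = reflect (infmat_apply (conjugate M) x)"
proof
  fix i
  let ?t = "complex_of_real \<tau>" and ?w = "\<lambda>j. complex_of_real (w j)"
    and ?g = "\<lambda>j. complex_of_real (image_vec M j)" and ?q = "complex_of_real (quad_form M)"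
    and ?W = "complex_of_real (\<Sum>j<m. (w j)\<^sup>2)"
  define P where "P = proj (infmat_apply M x)"
  have g: "(\<lambda>j. complex_of_real (M i j) * ?w j) sums ?g i"
  proof -
    have "(\<lambda>j. complex_of_real (M i j) * ?w j) sums (\<Sum>j<m. complex_of_real (M i j) * ?w j)"
      by (rule sums_finite) (auto simp: support)
    then show ?thesis
      by (simp add: image_vec_def)
  qed
  have "(\<lambda>j. complex_of_real (M i j) * x j - (?t * proj x) * (complex_of_real (M i j) * ?w j))
      sums (infmat_apply M x i - (?t * proj x) * ?g i)"
    by (intro sums_diff sums_mult infmat_apply_sums summable_row_finite row_finite g)
  then have "(\<lambda>j. complex_of_real (M i j) * reflect x j)
      sums (infmat_apply M x i - (?t * proj x) * ?g i)"
    by (simp add: reflect_alt algebra_simps)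
  then have lhs: "infmat_apply M (reflect x) i = infmat_apply M x i - (?t * proj x) * ?g i"
    unfolding infmat_apply_def[of M "reflect x"] by (rule sums_unique[symmetric])
  have N: "infmat_apply (conjugate M) x
      = (\<lambda>i. infmat_apply M x i - (?t * P) * ?w i - (?t * proj x) * ?g i
          + (?t * ?t * ?q * proj x) * ?w i)"
    unfolding P_def
    by (rule ext) (subst infmat_apply_def, rule sums_unique[symmetric], rule conjugate_sums)
  have projN: "proj (infmat_apply (conjugate M) x)
      = P - (?t * P) * ?W - (?t * proj x) * ?q + (?t * ?t * ?q * proj x) * ?W"
    unfolding N by (simp only: proj_add proj_diff proj_scale proj_w proj_image_vec) (simp add: P_def)
  have "reflect (infmat_apply (conjugate M) x) i
      = infmat_apply M x i - (?t * proj x) * ?g i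
        + (?t * ?t * ?W - 2 * ?t) * (P - ?t * ?q * proj x) * ?w i"
    by (simp only: reflect_apply projN) (simp add: N algebra_simps)
  then show "infmat_apply M (reflect x) i = reflect (infmat_apply (conjugate M) x) i"
    unfolding lhs by (simp only: tau_norm_complex) simp
qed

lemma conj_eq_reflect: "conj_eq reflect M (conjugate M)"
  using unitary_reflect reflect_in_ell2 summable_row_finite[OF row_finite]
    sums_summable[OF conjugate_sums] reflect_intertwining
  by (rule conj_eq_intertwining)

lemma conjugate_sym: "conjugate M i j = conjugate M j i"
  by (simp add: conjugate_def sym[of i j] algebra_simps)

end

end

text \<open>Here w = v - s e_l with |s| = |v|. This makes |w|^2 = 2 (s^2 - s v_l) = 2 (v, w), so the
  reflection subtracts exactly w from v and leaves s e_l.\<close>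

lemma householder_maps_to_axis:
  fixes v :: "nat \<Rightarrow> real"
  assumes "l < m" and s: "s\<^sup>2 = (\<Sum>j<m. (v j)\<^sup>2)" and i: "i < m"
    and w: "w = (\<lambda>i. if i < m then v i - (if i = l then s else 0) else 0)"
  shows "v i - 2 / (\<Sum>j<m. (w j)\<^sup>2) * w i * (\<Sum>j<m. v j * w j) = (if i = l then s else 0)"
proof -
  let ?W = "\<Sum>j<m. (w j)\<^sup>2"
  have "?W = (\<Sum>j<m. (v j)\<^sup>2 + (if j = l then s\<^sup>2 - 2 * s * v j else 0))"
    by (intro sum.cong) (auto simp: w power2_diff)
  also have "\<dots> = 2 * (s\<^sup>2 - s * v l)"
    using \<open>l < m\<close> by (simp add: sum.distrib s)
  finally have W: "?W = 2 * (s\<^sup>2 - s * v l)" .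
  have "(\<Sum>j<m. v j * w j) = (\<Sum>j<m. (v j)\<^sup>2 - (if j = l then s * v j else 0))"
    by (intro sum.cong) (auto simp: w power2_eq_square algebra_simps)
  also have "\<dots> = s\<^sup>2 - s * v l"
    using \<open>l < m\<close> by (simp add: sum_subtractf s)
  finally have vw: "(\<Sum>j<m. v j * w j) = ?W / 2"
    using W by simp
  show ?thesis
  proof (cases "?W = 0")
    \<comment> \<open>If \<open>w\<close> vanishes, \<open>v\<close> already lies on the axis and
      the reflection term is zero.\<close>
    case True
    then have "w i = 0"
      using i by (simp add: sum_nonneg_eq_0_iff)
    then show ?thesis
      using i by (simp add: w)
  next
    case False
    then show ?thesis
      using i by (simp add: vw) (simp add: w)
  qed
qed

section \<open>Coupled matrices and the removal of one row from the finite block\<close>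

text \<open>The matrix of the theorem as a function of its parameters; the reduction below leads
  from one matrix of this family to another.\<close>

definition coupled :: "real mat \<Rightarrow> real \<Rightarrow> (nat \<Rightarrow> real) \<Rightarrow> (nat \<Rightarrow> real) \<Rightarrow> infmat" where
  "coupled \<A> d \<beta> \<alpha> = block_infmat \<A> (coupling (dim_row \<A>) d)
     (infmat_transpose (coupling (dim_row \<A>) d)) (jacobi \<beta> \<alpha>)"

lemmas coupled_simps = coupled_def block_infmat_def coupling_def infmat_transpose_def jacobi_def

lemma coupled_sym:
  assumes "\<A> \<in> carrier_mat n n" "transpose_mat \<A> = \<A>"
  shows "coupled \<A> d \<beta> \<alpha> i j = coupled \<A> d \<beta> \<alpha> j i"
proof -
  have "\<A> $$ (i, j) = \<A> $$ (j, i)" if "i < n" "j < n"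
    using assms that by (metis carrier_matD index_transpose_mat(1))
  then show ?thesis
    using assms(1) by (auto simp: coupled_simps Let_def)
qed

lemma coupled_row_finite: "finite {j. coupled \<A> d \<beta> \<alpha> i j \<noteq> 0}"
proof (rule finite_subset)
  show "{j. coupled \<A> d \<beta> \<alpha> i j \<noteq> 0} \<subseteq> {..dim_row \<A> + i + 1}"
    by (rule subsetI, rule ccontr) (auto simp: coupled_simps Let_def split: if_splits)
qed simp

text \<open>Index \<open>m\<close>, the last one of the finite block, is counted with the Jacobi
  part: the corner entry becomes its first diagonal entry and the coupling \<open>d\<close> its
  first off-diagonal entry.\<close>

lemma coupled_tail:
  assumes "\<A> \<in> carrier_mat (Suc m) (Suc m)" "m \<le> i" "m \<le> j"
  shows "coupled \<A> d \<beta> \<alpha> i j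
    = jacobi (case_nat (\<A> $$ (m, m)) \<beta>) (case_nat d \<alpha>) (i - m) (j - m)"
proof -
  obtain a b where "i = m + a" "j = m + b"
    using assms(2,3) by (metis le_Suc_ex)
  then show ?thesis
    using assms(1) by (cases a; cases b) (auto simp: coupled_simps)
qed

text \<open>Zeros beside the corner entry detach index \<open>m\<close> from the rest of the block,
  and \<open>coupled_tail\<close> identifies everything from there on.\<close>

lemma coupled_last_column_zero:
  assumes A: "\<A> \<in> carrier_mat (Suc m) (Suc m)" "transpose_mat \<A> = \<A>"
    and zero: "\<And>j. j < m \<Longrightarrow> \<A> $$ (m, j) = 0"
  shows "coupled \<A> d \<beta> \<alpha> = direct_sum_infmat (mat m m (\<lambda>ij. \<A> $$ ij))
    (jacobi (case_nat (\<A> $$ (m, m)) \<beta>) (case_nat d \<alpha>))"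
proof (intro ext)
  fix i j
  let ?D = "direct_sum_infmat (mat m m (\<lambda>ij. \<A> $$ ij))
    (jacobi (case_nat (\<A> $$ (m, m)) \<beta>) (case_nat d \<alpha>))"
  have zero': "\<A> $$ (j, m) = 0" if "j < m" for j
    using A zero that by (metis carrier_matD index_transpose_mat(1) less_SucI lessI)
  have dim: "dim_row \<A> = Suc m"
    using A(1) by simp
  consider "i < m" "j < m" | "i < m" "j = m" | "i < m" "m < j" | "i = m" "j < m" | "m < i" "j < m"
    | "m \<le> i" "m \<le> j" by linarith
  then show "coupled \<A> d \<beta> \<alpha> i j = ?D i j"
  proof cases
    case 6
    then show ?thesis
      by (simp add: coupled_tail[OF A(1)] direct_sum_infmat_def block_infmat_def)
  qed (simp_all add: coupled_simps direct_sum_infmat_def dim zero zero')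
qed

text \<open>The reflection acts only on coordinates below \<open>m\<close>, so it leaves the tail
  starting at index \<open>m\<close> unchanged. The link between the two parts, column
  \<open>m\<close> above the diagonal, is turned into a single entry \<open>s\<close> in row
  \<open>m - 1\<close>, which is again a coupling.\<close>

lemma coupled_reduction:
  assumes A: "\<A> \<in> carrier_mat (Suc m) (Suc m)" "transpose_mat \<A> = \<A>"
    and nonzero: "j0 < m" "\<A> $$ (m, j0) \<noteq> 0"
  obtains U \<B> s where "unitary_ell2 U" "\<B> \<in> carrier_mat m m" "transpose_mat \<B> = \<B>" "s > 0"
    "conj_eq U (coupled \<A> d \<beta> \<alpha>)
      (coupled \<B> s (case_nat (\<A> $$ (m, m)) \<beta>) (case_nat d \<alpha>))"
proof -
  define v where "v j = \<A> $$ (m, j)" for j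
  define s where "s = sqrt (\<Sum>j<m. (v j)\<^sup>2)"
  \<comment> \<open>The target axis is \<open>m - 1\<close> because a coupling sits in the last row
    of the new block of order \<open>m\<close>. The index exists, since
    \<open>j0 < m\<close>.\<close>
  define w where "w = (\<lambda>i. if i < m then v i - (if i = m - 1 then s else 0) else 0)"
  define M where "M = coupled \<A> d \<beta> \<alpha>"
  interpret householder m w
    by unfold_locales (simp add: w_def)
  define \<B> where "\<B> = mat m m (\<lambda>(i, j). conjugate M i j)"
  have M_sym: "M i j = M j i" for i j
    unfolding M_def using A by (rule coupled_sym)
  have M_fin: "finite {j. M i j \<noteq> 0}" for i
    unfolding M_def by (rule coupled_row_finite)
  \<comment> \<open>The nonzero entry makes \<open>s\<close> strictly positive, as a coupling
    constant must be: it later becomes a Jacobi off-diagonal entry.\<close>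
  have "(\<Sum>j<m. (v j)\<^sup>2) > 0"
    using nonzero by (intro sum_pos2[of _ j0]) (auto simp: v_def)
  then have s: "s > 0" "s\<^sup>2 = (\<Sum>j<m. (v j)\<^sup>2)"
    by (simp_all add: s_def)
  have M_row: "M m j = v j" if "j < m" for j
    using A(1) that by (simp add: M_def v_def coupled_simps)
  have M_far: "M i j = 0" if "m < i" "j < m" for i j
    using A(1) that by (auto simp: M_def coupled_simps)
  have g_m: "image_vec M m = (\<Sum>j<m. v j * w j)"
    by (simp add: image_vec_def M_row)
  \<comment> \<open>Rows beyond \<open>m\<close> meet the old block at most in column
    \<open>m\<close>, outside the support of \<open>w\<close>. Hence the conjugation creates no new
    entries further out.\<close>
  have g_far: "image_vec M i = 0" if "m < i" for i
    using that by (simp add: image_vec_def M_far)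
  have conj_m: "conjugate M i m = (if i = m - 1 then s else 0)" if "i < m" for i
  proof -
    have "conjugate M i m = v i - \<tau> * w i * (\<Sum>j<m. v j * w j)"
      using that by (simp add: conjugate_def M_sym[of i m] M_row g_m support)
    also have "\<dots> = (if i = m - 1 then s else 0)"
      unfolding \<tau>_def using nonzero(1) s(2) that
      by (intro householder_maps_to_axis) (auto simp: w_def)
    finally show ?thesis .
  qed
  have conj_far: "conjugate M i j = 0" if "i < m" "m < j" for i j
    using that by (simp add: conjugate_def M_sym[of i j] M_far g_far support)
  have conj_low: "conjugate M i j = M i j" if "m \<le> i" "m \<le> j" for i j
    using that by (simp add: conjugate_def support)
  have M_low: "M i j = jacobi (case_nat (\<A> $$ (m, m)) \<beta>) (case_nat d \<alpha>) (i - m) (j - m)"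
    if "m \<le> i" "m \<le> j" for i j
    unfolding M_def using A(1) that by (rule coupled_tail)
  note conj_sym = conjugate_sym[OF M_sym M_fin]
  have B: "\<B> \<in> carrier_mat m m" "transpose_mat \<B> = \<B>"
    by (auto simp: \<B>_def conj_sym intro!: eq_matI)
  have "conjugate M = coupled \<B> s (case_nat (\<A> $$ (m, m)) \<beta>) (case_nat d \<alpha>)"
  proof (intro ext)
    fix i j
    let ?C = "coupled \<B> s (case_nat (\<A> $$ (m, m)) \<beta>) (case_nat d \<alpha>)"
    \<comment> \<open>It suffices to compare the rows below \<open>m\<close> and the common tail;
      the remaining corner follows by symmetry of both matrices.\<close>
    have upper: "conjugate M i j = ?C i j" if "i < m" for i j
    proof -
      consider "j < m" | "j = m" | "m < j" by linarith
      then show ?thesis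
        using that
        by cases (simp_all add: coupled_def block_infmat_def coupling_def \<B>_def conj_m conj_far)
    qed
    have C_sym: "?C i j = ?C j i"
      using B by (rule coupled_sym)
    consider "i < m" | "j < m" | "m \<le> i" "m \<le> j" by linarith
    then show "conjugate M i j = ?C i j"
    proof cases
      case 3
      then show ?thesis
        by (simp add: conj_low M_low coupled_def block_infmat_def \<B>_def)
    qed (use upper conj_sym C_sym in metis)+
  qed
  then have "conj_eq reflect (coupled \<A> d \<beta> \<alpha>)
      (coupled \<B> s (case_nat (\<A> $$ (m, m)) \<beta>) (case_nat d \<alpha>))"
    using conj_eq_reflect[OF M_sym M_fin] by (simp add: M_def)
  then show thesis
    using that unitary_reflect B s(1) by blast
qed

section \<open>Chains of extensions and induction on the order of the block\<close>

lemma jacobi_extension_case_nat: "jacobi_extension (case_nat b \<beta>) (case_nat a \<alpha>) \<beta> \<alpha>"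
  by (auto simp: jacobi_extension_def intro!: exI[of _ 1])

lemma jacobi_extension_trans:
  assumes "jacobi_extension b1 a1 b2 a2" "jacobi_extension b2 a2 b3 a3"
  shows "jacobi_extension b1 a1 b3 a3"
proof -
  obtain p q where "1 \<le> p" "\<And>j. b2 j = b1 (j + p) \<and> a2 j = a1 (j + p)"
    and "\<And>j. b3 j = b2 (j + q) \<and> a3 j = a2 (j + q)"
    using assms unfolding jacobi_extension_def by blast
  then show ?thesis
    unfolding jacobi_extension_def by (intro exI[of _ "q + p"]) (simp add: add.assoc)
qed

text \<open>The coupling and the Jacobi parameters are generalized because each reduction replaces
  \<open>d\<close> by \<open>s\<close> and prepends one entry to each sequence. \<open>k\<close>
  counts the prepended rows.\<close>

lemma coupled_decomposition:
  assumes "\<A> \<in> carrier_mat (Suc m) (Suc m)" "transpose_mat \<A> = \<A>" "d > 0" "\<And>j. \<alpha> j > 0"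
  shows "\<exists>k \<A>' \<beta>' \<alpha>' U. 1 \<le> k \<and> k \<le> Suc m \<and>
           \<A>' \<in> carrier_mat (Suc m - k) (Suc m - k) \<and> transpose_mat \<A>' = \<A>' \<and>
           (\<forall>j. \<alpha>' j > 0) \<and> jacobi_extension \<beta>' \<alpha>' \<beta> \<alpha> \<and> unitary_ell2 U \<and>
           conj_eq U (coupled \<A> d \<beta> \<alpha>) (direct_sum_infmat \<A>' (jacobi \<beta>' \<alpha>'))"
  using assms
proof (induction m arbitrary: \<A> d \<beta> \<alpha> rule: less_induct)
  case (less m)
  note A = less.prems(1,2)
  let ?\<beta> = "case_nat (\<A> $$ (m, m)) \<beta>" and ?\<alpha> = "case_nat d \<alpha>"
  have pos: "?\<alpha> j > 0" for j
    using less.prems by (cases j) auto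
  show ?case
  proof (cases "\<forall>j<m. \<A> $$ (m, j) = 0")
    case True
    let ?A = "mat m m (\<lambda>ij. \<A> $$ ij)"
    have "\<A> $$ (i, j) = \<A> $$ (j, i)" if "i < m" "j < m" for i j
      using A that by (metis carrier_matD index_transpose_mat(1) less_SucI)
    then have "transpose_mat ?A = ?A"
      by (intro eq_matI) auto
    moreover have "conj_eq id (coupled \<A> d \<beta> \<alpha>) (direct_sum_infmat ?A (jacobi ?\<beta> ?\<alpha>))"
      using coupled_last_column_zero[OF A] True conj_eq_id by simp
    \<comment> \<open>Only the corner row moves into the Jacobi part, so \<open>k\<close> is 1 and
      the unitary is the identity.\<close>
    ultimately show ?thesis
      using pos jacobi_extension_case_nat unitary_ell2_id
      by (rule_tac exI[of _ 1], rule_tac exI[of _ ?A], rule_tac exI[of _ ?\<beta>],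
          rule_tac exI[of _ ?\<alpha>], rule_tac exI[of _ id]) (simp add: id_def)
  next
    case False
    then obtain j0 where j0: "j0 < m" "\<A> $$ (m, j0) \<noteq> 0" by blast
    obtain V \<B> s where V: "unitary_ell2 V"
        "conj_eq V (coupled \<A> d \<beta> \<alpha>) (coupled \<B> s ?\<beta> ?\<alpha>)"
      and B: "\<B> \<in> carrier_mat m m" "transpose_mat \<B> = \<B>" "s > 0"
      using coupled_reduction[OF A j0] by metis
    \<comment> \<open>A nonzero entry beside the corner forces \<open>m > 0\<close>, so the reduced
      block again has order at least 1, as the induction hypothesis requires.\<close>
    obtain l where l: "m = Suc l"
      using j0 by (cases m) auto
    obtain k \<A>' \<beta>' \<alpha>' W where k: "1 \<le> k" "k \<le> m" and
        A': "\<A>' \<in> carrier_mat (m - k) (m - k)" "transpose_mat \<A>' = \<A>'" and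
        J: "\<forall>j. \<alpha>' j > 0" "jacobi_extension \<beta>' \<alpha>' ?\<beta> ?\<alpha>" and
        W: "unitary_ell2 W" "conj_eq W (coupled \<B> s ?\<beta> ?\<alpha>) (direct_sum_infmat \<A>' (jacobi \<beta>' \<alpha>'))"
      using less.IH[of l \<B> s ?\<alpha> ?\<beta>] B pos unfolding l by blast
    have "jacobi_extension \<beta>' \<alpha>' \<beta> \<alpha>"
      using J(2) jacobi_extension_case_nat by (rule jacobi_extension_trans)
    moreover have "unitary_ell2 (V \<circ> W)"
      using V(1) W(1) by (rule unitary_ell2_comp)
    moreover have "conj_eq (V \<circ> W) (coupled \<A> d \<beta> \<alpha>) (direct_sum_infmat \<A>' (jacobi \<beta>' \<alpha>'))"
      using V W by (rule conj_eq_comp)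
    \<comment> \<open>The row prepended in this reduction raises \<open>k\<close> by one, and
      \<open>Suc m - Suc k = m - k\<close> keeps the order of the finite summand.\<close>
    ultimately show ?thesis
      using k A' J(1)
      by (rule_tac exI[of _ "Suc k"], rule_tac exI[of _ \<A>'], rule_tac exI[of _ \<beta>'],
          rule_tac exI[of _ \<alpha>'], rule_tac exI[of _ "V \<circ> W"]) (simp add: comp_def)
  qed
qed

theorem theorem1:
  fixes n :: nat and \<A> :: "real mat" and d :: real and \<beta> \<alpha> :: "nat \<Rightarrow> real"
  assumes "n \<ge> 1"
    and "\<A> \<in> carrier_mat n n"
    and "transpose_mat \<A> = \<A>"
    and "d > 0"
    and "\<And>j. \<alpha> j > 0"
  shows "\<exists>k \<A>' \<beta>' \<alpha>' U.
           1 \<le> k \<and> k \<le> n \<and>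
           \<A>' \<in> carrier_mat (n - k) (n - k) \<and> transpose_mat \<A>' = \<A>' \<and>
           (\<forall>j. \<alpha>' j > 0) \<and> jacobi_extension \<beta>' \<alpha>' \<beta> \<alpha> \<and>
           unitary_ell2 U \<and>
           conj_eq U
             (block_infmat \<A> (coupling n d) (infmat_transpose (coupling n d)) (jacobi \<beta> \<alpha>))
             (direct_sum_infmat \<A>' (jacobi \<beta>' \<alpha>'))"
proof -
  obtain m where "n = Suc m"
    using assms(1) by (cases n) auto
  moreover have "dim_row \<A> = n"
    using assms(2) by simp
  ultimately show ?thesis
    using coupled_decomposition[of \<A> m d \<alpha> \<beta>] assms by (simp add: coupled_def)
qed

end
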